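(* Let $m\ge 2$, $n\ge 1$ and let $A\colon\mathbb{N}^m\to\mathcal{M}_n(\mathbb{R})$ be such that $A(t)$ is invertible for all $t\in\mathbb{N}^m$. Suppose there exists an integer $T\ge 1$ such that $A(t+T\cdot{\bf 1})=A(t)$ for all $t\in\mathbb{N}^m$. Let $\Phi$ be the fundamental matrix of the recurrence $x(t+{\bf 1})=A(t)x(t)$, and let $B\colon\mathbb{N}^m\to\mathcal{M}_n(\mathbb{C})$ be given by $B(t)=\widetilde{B}\big(t-\mu(t)\cdot{\bf 1}\big)$, where, for each $t\in\mathbb{N}^m$, $\widetilde{B}(t)\in\mathcal{M}_n(\mathbb{C})$ is a fixed (arbitrarily chosen) matrix with $\widetilde{B}(t)^T=\widetilde{A}(t)$ ($T$-th power). Then there exists a function $P\colon\mathbb{N}^m\to\mathcal{M}_n(\mathbb{C})$ such that $P(t+T\cdot{\bf 1})=P(t)$ for all $t\in\mathbb{N}^m$ and $$\Phi(t)=P(t)\,B(t)^{\mu(t)}\qquad\text{for all } t\in\mathbb{N}^m .$$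
   Context: $\mathbb{N}=\{0,1,2,\ldots\}$; $\mathcal{M}_n(K)$ is the set of $n\times n$ matrices over $K$. For $t=(t^1,\ldots,t^m)\in\mathbb{N}^m$, $\mu(t)=\min\{t^1,\ldots,t^m\}$, and ${\bf 1}=(1,\ldots,1)\in\mathbb{N}^m$. A superscript $T$ on a matrix denotes the $T$-th power (not the transpose). The fundamental matrix associated to the recurrence $x(t+{\bf 1})=A(t)x(t)$, $t\in\mathbb{N}^m$, is the function $\Phi\colon\mathbb{N}^m\to\mathcal{M}_n(\mathbb{R})$ defined by $\Phi(t)=A(t-{\bf 1})A(t-2\cdot{\bf 1})\cdots A(t-\mu(t)\cdot{\bf 1})$ if $\mu(t)\ge1$, and $\Phi(t)=I_n$ if $\mu(t)=0$. The function $\widetilde{A}\colon\mathbb{N}^m\to\mathcal{M}_n(\mathbb{R})$ is $\widetilde A(t)=A(t+(T-1)\cdot{\bf 1})A(t+(T-2)\cdot{\bf 1})\cdots A(t+{\bf 1})A(t)$. Since $\widetilde A(t)$ is invertible, a complex matrix $\widetilde B(t)$ with $\widetilde B(t)^T=\widetilde A(t)$ exists (it is not unique); one such matrix is fixed for each $t$. *)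

theory Defs
  imports "HOL-Analysis.Analysis"
begin

(* Multi-times are vectors of type nat ^ 'm, where 1 is the all-ones vector and
   k *s 1 is the vector (k, ..., k). *)

definition mu :: "nat ^ 'm \<Rightarrow> nat" where
  "mu t = Min (range (\<lambda>i. t $ i))"

(* The library's times and power on vectors act componentwise, so they are not the
   matrix product (written with a double asterisk) and the matrix power below. *)

primrec matpow :: "'a::semiring_1 ^ 'n ^ 'n \<Rightarrow> nat \<Rightarrow> 'a ^ 'n ^ 'n" where
  "matpow M 0 = mat 1"
| "matpow M (Suc k) = M ** matpow M k"

(* Ordered product, the head of the list being the leftmost factor. *)

definition matprod :: "('a::semiring_1 ^ 'n ^ 'n) list \<Rightarrow> 'a ^ 'n ^ 'n" where
  "matprod Ms = foldr (**) Ms (mat 1)"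

(* A(t - 1) A(t - 2.1) ... A(t - mu(t).1); the empty product when mu t = 0.
   The truncated subtraction is exact because k \<le> mu t for every factor. *)

definition fundamental_matrix ::
  "(nat ^ 'm \<Rightarrow> real ^ 'n ^ 'n) \<Rightarrow> nat ^ 'm \<Rightarrow> real ^ 'n ^ 'n" where
  "fundamental_matrix A t = matprod (map (\<lambda>k. A (t - k *s 1)) [1..<Suc (mu t)])"

(* A(t + (T - 1).1) ... A(t + 1) A(t) *)

definition period_matrix ::
  "(nat ^ 'm \<Rightarrow> real ^ 'n ^ 'n) \<Rightarrow> nat \<Rightarrow> nat ^ 'm \<Rightarrow> real ^ 'n ^ 'n" where
  "period_matrix A T t = matprod (map (\<lambda>k. A (t + k *s 1)) (rev [0..<T]))"

end

theory Submission
  imports Defs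
begin

text \<open>Along the diagonal through \<open>t\<close> the solution operator is a product of values of \<open>A\<close> starting
  at the base point \<open>s = t - \<mu>(t) 1\<close>, so periodicity gives \<open>\<Phi>(t + T 1) = \<Phi>(t) B(t)\<^sup>T\<close>, while the
  base point, and hence \<open>B\<close>, does not change under \<open>t \<mapsto> t + T 1\<close>. Therefore
  \<open>P(t) = \<Phi>(t) B(t)\<^bsup>-\<mu>(t)\<^esup>\<close> is periodic.\<close>

lemma mu_le: "mu t \<le> t $ i"
  unfolding mu_def by (intro Min_le) auto

lemma mu_add_diagonal: "mu (t + k *s 1) = mu t + k"
proof -
  have "range (\<lambda>i. (t + k *s 1) $ i) = (\<lambda>x. x + k) ` range (\<lambda>i. t $ i)"
    by auto
  moreover have "Min ((\<lambda>x. x + k) ` range (\<lambda>i. t $ i)) = Min (range (\<lambda>i. t $ i)) + k"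
    by (intro mono_Min_commute[symmetric]) (auto intro: monoI)
  ultimately show ?thesis
    by (simp add: mu_def)
qed

lemma base_point_add_diagonal:
  "(t + k *s 1) - mu (t + k *s 1) *s 1 = t - mu t *s 1"
  by (simp add: vec_eq_iff mu_add_diagonal)

lemma matprod_append: "matprod (Ms @ Ns) = matprod Ms ** matprod Ns"
  by (induction Ms) (simp_all add: matprod_def matrix_mul_assoc)

lemma matprod_invertible:
  fixes Ms :: "('a::field ^ 'n ^ 'n) list"
  assumes "\<And>M. M \<in> set Ms \<Longrightarrow> invertible M"
  shows "invertible (matprod Ms)"
  using assms
  by (induction Ms) (auto simp: matprod_def invertible_mult invertible_def[of "mat 1"])

lemma matpow_add: "matpow M (j + k) = matpow M j ** matpow M k"
  by (induction j) (simp_all add: matrix_mul_assoc)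

lemma matpow_right_inverse:
  assumes "M ** N = mat 1"
  shows "matpow M k ** matpow N k = mat 1"
proof (induction k)
  case (Suc k)
  \<comment> \<open>\<open>matpow\<close> adds factors on the left. Writing \<open>Suc k\<close> as
    \<open>k + 1\<close> lets \<open>matpow_add\<close> split one \<open>M\<close> off on the right,
    where it meets the leading \<open>N\<close> and cancels without any commutation.\<close>
  have "matpow M (Suc k) ** matpow N (Suc k)
      = matpow M (k + 1) ** (N ** matpow N k)"
    by simp
  also have "\<dots> = matpow M k ** (M ** N) ** matpow N k"
    unfolding matpow_add by (simp add: matrix_mul_assoc)
  finally show ?case
    using assms Suc by simp
qed simp

lemma map_matrix_of_real_mult:
  "map_matrix complex_of_real (M ** N) =
     map_matrix complex_of_real M ** map_matrix complex_of_real N"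
  by (simp add: vec_eq_iff matrix_matrix_mult_def map_matrix_def)

lemma map_matrix_of_real_invertible:
  fixes M :: "real ^ 'n ^ 'n"
  assumes "invertible M"
  shows "invertible (map_matrix complex_of_real M)"
proof -
  obtain N where "M ** N = mat 1" "N ** M = mat 1"
    using assms unfolding invertible_def by blast
  moreover have "map_matrix complex_of_real (mat 1 :: real ^ 'n ^ 'n) = mat 1"
    by (simp add: vec_eq_iff mat_def map_matrix_def)
  ultimately show ?thesis
    unfolding invertible_def by (metis map_matrix_of_real_mult)
qed

text \<open>For \<open>k = Suc j\<close>, \<open>matpow M j\<close> times an inverse of the power is
  a right inverse of \<open>M\<close>, which suffices for square matrices over a field. For
  \<open>k = 0\<close> the power is \<open>mat 1\<close> whatever \<open>M\<close> is.\<close>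

lemma invertible_matpowD:
  fixes M :: "'a::field ^ 'n ^ 'n"
  assumes "invertible (matpow M k)" and "k \<ge> 1"
  shows "invertible M"
proof -
  obtain j where "k = Suc j"
    using \<open>k \<ge> 1\<close> by (cases k) auto
  then obtain N where "(M ** matpow M j) ** N = mat 1"
    using assms(1) unfolding invertible_def by auto
  then have "M ** (matpow M j ** N) = mat 1"
    by (simp add: matrix_mul_assoc)
  then show ?thesis
    using invertible_right_inverse by blast
qed

text \<open>Counting the factors upwards from the base point instead of downwards from
  \<open>t\<close> reverses the index list and makes both products instances of one function, with
  lengths \<open>mu t\<close> and \<open>T\<close>.\<close>

lemma fundamental_matrix_eq_period_matrix:
  "fundamental_matrix A t = period_matrix A (mu t) (t - mu t *s 1)"
proof -
  \<comment> \<open>List position \<open>i\<close> carries the index \<open>Suc i\<close>. The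
    truncated subtractions are exact because \<open>Suc i \<le> mu t \<le> t $ j\<close> for every
    component \<open>j\<close>.\<close>
  have "t - Suc i *s 1 = t - mu t *s 1 + (mu t - Suc i) *s 1" if "i < mu t" for i
  proof -
    have "t $ j - Suc i = t $ j - mu t + (mu t - Suc i)" for j
      using mu_le[of t j] that by linarith
    then show ?thesis
      by (simp add: vec_eq_iff)
  qed
  then have "map (\<lambda>k. A (t - k *s 1)) [1..<Suc (mu t)]
      = map (\<lambda>k. A (t - mu t *s 1 + k *s 1)) (rev [0..<mu t])"
    by (intro nth_equalityI) (simp_all add: rev_nth del: upt_Suc)
  then show ?thesis
    by (simp only: fundamental_matrix_def period_matrix_def)
qed

text \<open>Later times stand further left, so cutting the reversed index range at \<open>T\<close>
  leaves the \<open>T\<close> earliest factors on the right: the cocycle property of the solution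
  operator.\<close>

lemma period_matrix_add:
  "period_matrix A (k + T) s = period_matrix A k (s + T *s 1) ** period_matrix A T s"
proof -
  have "map (\<lambda>j. A (s + j *s 1)) (rev [0..<k + T])
      = map (\<lambda>j. A (s + T *s 1 + j *s 1)) (rev [0..<k]) @
        map (\<lambda>j. A (s + j *s 1)) (rev [0..<T])"
    by (induction k) (simp_all add: vec_eq_iff ac_simps)
  then show ?thesis
    by (simp add: period_matrix_def matprod_append)
qed

lemma period_matrix_periodic:
  assumes "\<And>t. A (t + T *s 1) = A t"
  shows "period_matrix A k (s + T *s 1) = period_matrix A k s"
proof -
  have "A (s + T *s 1 + j *s 1) = A (s + j *s 1)" for j
    using assms[of "s + j *s 1"] by (simp add: ac_simps)
  then show ?thesis
    by (simp add: period_matrix_def)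
qed

text \<open>The shift keeps the base point and lengthens the product by \<open>T\<close>. Once the
  \<open>T\<close> earliest factors are split off on the right, the others start one period later
  and so form the old product.\<close>

lemma fundamental_matrix_add_period:
  assumes "\<And>t. A (t + T *s 1) = A t"
  shows "fundamental_matrix A (t + T *s 1)
    = fundamental_matrix A t ** period_matrix A T (t - mu t *s 1)"
  unfolding fundamental_matrix_eq_period_matrix base_point_add_diagonal
  by (simp add: mu_add_diagonal period_matrix_add period_matrix_periodic[where A = A and T = T, OF assms])

theorem theorem2:
  fixes A :: "nat ^ 'm \<Rightarrow> real ^ 'n ^ 'n"
    and Bt B :: "nat ^ 'm \<Rightarrow> complex ^ 'n ^ 'n"
    and T :: nat
  assumes "CARD('m) \<ge> 2"
    and "\<And>t. invertible (A t)"
    and "T \<ge> 1"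
    and "\<And>t. A (t + T *s 1) = A t"
    and "\<And>t. matpow (Bt t) T = map_matrix complex_of_real (period_matrix A T t)"
    and "\<And>t. B t = Bt (t - mu t *s 1)"
  shows "\<exists>P :: nat ^ 'm \<Rightarrow> complex ^ 'n ^ 'n.
           (\<forall>t. P (t + T *s 1) = P t) \<and>
           (\<forall>t. map_matrix complex_of_real (fundamental_matrix A t)
                  = P t ** matpow (B t) (mu t))"
proof -
  define C where "C t = matrix_inv (B t)" for t
  define \<Phi> where "\<Phi> t = map_matrix complex_of_real (fundamental_matrix A t)" for t
  define P where "P t = \<Phi> t ** matpow (C t) (mu t)" for t
  have B_pow: "matpow (B t) T
      = map_matrix complex_of_real (period_matrix A T (t - mu t *s 1))" for t
    using assms(5,6) by simp
  \<comment> \<open>The \<open>T\<close>-th power of \<open>B t\<close> is the complexification of a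
    product of invertible values of \<open>A\<close>.\<close>
  have "invertible (B t)" for t
  proof (rule invertible_matpowD)
    show "invertible (matpow (B t) T)"
      unfolding B_pow period_matrix_def
      by (intro map_matrix_of_real_invertible matprod_invertible) (auto simp: assms(2))
  qed fact
  then have BC: "B t ** C t = mat 1" and CB: "C t ** B t = mat 1" for t
    \<comment> \<open>\<open>matrix_inv\<close> is a choice of a two-sided inverse, so invertibility
      yields both equations. Periodicity of \<open>P\<close> uses \<open>BC\<close>, the
      factorization of \<open>\<Phi>\<close> uses \<open>CB\<close>.\<close>
    using someI_ex[of "\<lambda>N. B t ** N = mat 1 \<and> N ** B t = mat 1"]
    by (auto simp: C_def matrix_inv_def invertible_def)
  have "P (t + T *s 1) = P t" for t
  proof -
    have "B (t + T *s 1) = B t"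
      by (simp only: assms(6) base_point_add_diagonal)
    then have "C (t + T *s 1) = C t"
      by (simp only: C_def)
    \<comment> \<open>The exponent is ordered as \<open>T + mu t\<close> so that
      \<open>matpow (C t) T\<close> comes first, next to the factor \<open>matpow (B t) T\<close>
      that \<Phi> gains over a period.\<close>
    then have "P (t + T *s 1) = \<Phi> (t + T *s 1) ** matpow (C t) (T + mu t)"
      by (simp add: P_def mu_add_diagonal add.commute)
    also have "\<dots> = \<Phi> t ** (matpow (B t) T ** matpow (C t) T) ** matpow (C t) (mu t)"
      by (simp add: \<Phi>_def fundamental_matrix_add_period[where A = A and T = T, OF assms(4)]
          map_matrix_of_real_mult B_pow matpow_add matrix_mul_assoc)
    also have "\<dots> = P t"
      by (simp add: matpow_right_inverse[OF BC] P_def)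
    finally show ?thesis .
  qed
  moreover have "\<Phi> t = P t ** matpow (B t) (mu t)" for t
    unfolding P_def
    by (simp add: matpow_right_inverse[OF CB] matrix_mul_assoc[symmetric])
  ultimately show ?thesis
    unfolding \<Phi>_def by blast
qed

end
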